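(* Let $\Omega\subset\mathbb{R}$ be a compact interval of length at least $1$. Let $x_1,\dots,x_N\in\mathbb{R}$ be pairwise distinct, let $\mu_N=\frac1N\sum_{i=1}^N\delta_{x_i}$, let $\sigma_N$ be the $W_2$-projection of $\mu_N$ on $\{\rho\in\mathcal{P}(\Omega):\rho\le1\}$, and let $T$ be the optimal transport map from $\sigma_N$ to $\mu_N$. Define the Laguerre cells and their barycenters by $$L_i=T^{-1}(\{x_i\}),\qquad \beta_i=N\int_{L_i}x\,d\sigma_N(x).$$ Then, choosing $\varepsilon=1/N$, $$\frac1{\varepsilon^2}W_2^2\Bigl(\sigma_N,\frac1N\sum_{i=1}^N\delta_{\beta_i}\Bigr)\le\frac1{12}.$$
   Context: $\mathcal{P}(\Omega)$ is the set of probability measures on $\Omega$; $\rho\le 1$ means that $\rho$ is absolutely continuous with density at most $1$ a.e. $W_2$ is the quadratic Wasserstein distance. The $W_2$-projection of $\mu_N$ on $\{\rho\in\mathcal{P}(\Omega):\rho\le1\}$ is the (unique) minimizer of $\sigma\mapsto W_2^2(\mu_N,\sigma)$ over this set. The optimal transport map is for the quadratic cost $|x-y|^2$ and is unique $\sigma_N$-a.e. *)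

theory Defs
  imports "HOL-Probability.Probability"
begin

text \<open>Measures on the real line are Borel measures, i.e. \<open>sets \<rho> = sets borel\<close>.\<close>

text \<open>A probability measure on \<open>\<Omega>\<close> is represented as a Borel probability measure on the
  whole line that is concentrated on \<open>\<Omega>\<close>.\<close>

definition prob_measures_on :: "real set \<Rightarrow> real measure set" where
  "prob_measures_on \<Omega> = {\<rho>. prob_space \<rho> \<and> sets \<rho> = sets borel \<and> emeasure \<rho> \<Omega> = 1}"

definition density_le_one :: "real measure \<Rightarrow> bool" where
  "density_le_one \<rho> \<longleftrightarrow>
    (\<exists>f \<in> borel_measurable lborel. \<rho> = density lborel f \<and> (AE x in lborel. f x \<le> 1))"

definition couplings :: "real measure \<Rightarrow> real measure \<Rightarrow> (real \<times> real) measure set" where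
  "couplings \<mu> \<nu> = {\<gamma>. sets \<gamma> = sets (borel \<Otimes>\<^sub>M borel) \<and>
     distr \<gamma> borel fst = \<mu> \<and> distr \<gamma> borel snd = \<nu>}"

text \<open>The square of the Wasserstein distance, with values in \<open>[0, \<infinity>]\<close>; it is \<open>\<infinity>\<close> when
  there is no coupling of finite cost.\<close>

definition W2_sq :: "real measure \<Rightarrow> real measure \<Rightarrow> ennreal" where
  "W2_sq \<mu> \<nu> = (INF \<gamma> \<in> couplings \<mu> \<nu>. \<integral>\<^sup>+ (x, y). ennreal (\<bar>x - y\<bar>\<^sup>2) \<partial>\<gamma>)"

text \<open>The measure giving mass \<open>1 / N\<close> to each of \<open>x 1, \<dots>, x N\<close>, counted with multiplicity.\<close>

definition empirical_measure :: "nat \<Rightarrow> (nat \<Rightarrow> real) \<Rightarrow> real measure" where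
  "empirical_measure N x = distr (uniform_count_measure {1..N}) borel x"

definition is_W2_projection :: "real set \<Rightarrow> real measure \<Rightarrow> real measure \<Rightarrow> bool" where
  "is_W2_projection \<Omega> \<mu> \<sigma> \<longleftrightarrow>
    is_arg_min (\<lambda>\<rho>. W2_sq \<mu> \<rho>) (\<lambda>\<rho>. \<rho> \<in> prob_measures_on \<Omega> \<and> density_le_one \<rho>) \<sigma>"

definition transport_maps :: "real measure \<Rightarrow> real measure \<Rightarrow> (real \<Rightarrow> real) set" where
  "transport_maps \<sigma> \<mu> = {T \<in> borel_measurable borel. distr \<sigma> borel T = \<mu>}"

definition is_optimal_transport_map :: "real measure \<Rightarrow> real measure \<Rightarrow> (real \<Rightarrow> real) \<Rightarrow> bool" where
  "is_optimal_transport_map \<sigma> \<mu> T \<longleftrightarrow>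
    is_arg_min (\<lambda>S. \<integral>\<^sup>+ y. ennreal (\<bar>y - S y\<bar>\<^sup>2) \<partial>\<sigma>) (\<lambda>S. S \<in> transport_maps \<sigma> \<mu>) T"

end

theory Submission
  imports Defs
begin

text \<open>The restriction of the projection \<open>\<sigma>\<close> to each Laguerre cell is Lebesgue measure on an interval of
  length \<open>1 / N\<close>. Granting this, \<open>\<beta> i\<close> is the midpoint of the \<open>i\<close>-th interval, the map that sends each
  cell to its barycenter has cost \<open>N * ((1 / N) ^ 3 / 12) = (1 / N)\<^sup>2 / 12\<close>, and multiplying by \<open>N\<^sup>2\<close>
  gives the bound.

  The structure of \<open>\<sigma>\<close> comes from two optimality properties. First, \<open>T\<close> is optimal. Sort the points and
  cut the line at the quantiles of \<open>\<sigma>\<close> of levels \<open>k / N\<close>. An explicit pair of dual potentials certifies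
  that the monotone map, which sends the \<open>k\<close>-th quantile cell to the \<open>k\<close>-th point, is optimal among all
  couplings, and that any optimal map agrees with it almost everywhere (\<open>contact_map_optimal\<close>,
  \<open>step_map_optimal\<close>). So the Laguerre cells are the quantile intervals up to null sets, and the squared
  distance from \<open>\<mu>\<close> to \<open>\<sigma>\<close> is the sum over the cells of the second moments about the points.

  Second, \<open>\<sigma>\<close> is a closest measure of density at most one. Rearrange the mass \<open>1 / N\<close> inside each
  quantile interval with density one on the subinterval of length \<open>1 / N\<close> closest to the point of that
  cell. This is again admissible and does not increase any of the second moments; a moment stays the same
  only if \<open>\<sigma>\<close> already had this form there (\<open>bathtub\<close>). By minimality no moment can drop, so
  \<open>\<sigma>\<close> has this form in every cell (\<open>projection_uniform_on_intervals\<close>).\<close>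

section \<open>Empirical measures and partitions into cells of equal mass\<close>

lemma emeasure_empirical_measure:
  assumes "N \<ge> 1" "A \<in> sets borel"
  shows "emeasure (empirical_measure N z) A = (\<Sum>i\<in>{1..N}. ennreal (1 / real N) * indicator A (z i))"
proof -
  have "emeasure (empirical_measure N z) A = ennreal (real (card {i \<in> {1..N}. z i \<in> A}) / real N)"
    using assms unfolding empirical_measure_def
    by (subst emeasure_distr)
       (auto simp: space_uniform_count_measure Int_def vimage_def measurable_def
          sets_uniform_count_measure emeasure_uniform_count_measure_if conj_ac)
  also have "\<dots> = ennreal (\<Sum>i\<in>{1..N}. 1 / real N * indicator A (z i))"
  proof -
    have "(\<Sum>i\<in>{1..N}. indicator A (z i)) = real (card {i \<in> {1..N}. z i \<in> A})"
      by (simp add: indicator_def Int_def)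
    then show ?thesis by (simp only: sum_divide_distrib[symmetric] mult_1_left times_divide_eq_left)
  qed
  also have "\<dots> = (\<Sum>i\<in>{1..N}. ennreal (1 / real N) * indicator A (z i))"
  proof -
    have "(\<Sum>i\<in>{1..N}. ennreal (1 / real N) * indicator A (z i)) =
        (\<Sum>i\<in>{1..N}. ennreal (1 / real N * indicator A (z i)))"
      by (intro sum.cong) (auto split: split_indicator)
    also have "\<dots> = ennreal (\<Sum>i\<in>{1..N}. 1 / real N * indicator A (z i))"
      by (rule sum_ennreal) simp
    finally show ?thesis by simp
  qed
  finally show ?thesis .
qed

lemma sets_empirical_measure [measurable_cong, simp]: "sets (empirical_measure N z) = sets borel"
  by (simp add: empirical_measure_def)

text \<open>Only the set of atoms matters, not their numbering. This is what allows the points to be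
  sorted in increasing order.\<close>

lemma empirical_measure_cong_image:
  assumes "N \<ge> 1" "inj_on z {1..N}" "inj_on x {1..N}" "z ` {1..N} = x ` {1..N}"
  shows "empirical_measure N z = empirical_measure N x"
proof (rule measure_eqI)
  fix A assume "A \<in> sets (empirical_measure N z)"
  then have A: "A \<in> sets borel" by simp
  have *: "emeasure (empirical_measure N w) A = (\<Sum>t\<in>w ` {1..N}. ennreal (1 / real N) * indicator A t)"
    if "inj_on w {1..N}" for w
    using assms(1) A by (simp only: emeasure_empirical_measure sum.reindex[OF that] comp_def)
  show "emeasure (empirical_measure N z) A = emeasure (empirical_measure N x) A"
    using assms by (simp add: *)
qed simp

lemma AE_empirical_measure:
  assumes "N \<ge> 1"
  shows "AE t in empirical_measure N z. t \<in> z ` {1..N}"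
  unfolding empirical_measure_def
  by (subst AE_distr_iff)
     (auto simp: space_uniform_count_measure sets_uniform_count_measure measurable_def uniform_count_measure_def
        intro!: AE_I2 borel_closed finite_imp_closed simp: space_point_measure)

text \<open>The masses of the cells add up to one, so the complement of their union is null.\<close>

locale equal_cells = prob_space \<rho> for \<rho> :: "'a measure" +
  fixes N :: nat and C :: "nat \<Rightarrow> 'a set"
  assumes N: "N \<ge> 1"
    and sets_C [measurable]: "\<And>i. i \<in> {1..N} \<Longrightarrow> C i \<in> sets \<rho>"
    and disjoint_C: "disjoint_family_on C {1..N}"
    and mass_C: "\<And>i. i \<in> {1..N} \<Longrightarrow> emeasure \<rho> (C i) = ennreal (1 / real N)"
begin

lemma AE_covered: "AE y in \<rho>. y \<in> (\<Union>i\<in>{1..N}. C i)"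
proof (rule AE_prob_1)
  have "measure \<rho> (\<Union>i\<in>{1..N}. C i) = (\<Sum>i\<in>{1..N}. measure \<rho> (C i))"
    using sets_C disjoint_C by (intro finite_measure_finite_Union) auto
  also have "\<dots> = (\<Sum>i\<in>{1..N}. 1 / real N)"
    by (intro sum.cong) (auto simp: measure_def mass_C)
  also have "\<dots> = 1" using N by simp
  finally show "measure \<rho> (\<Union>i\<in>{1..N}. C i) = 1" .
qed

lemma nn_integral_cells:
  assumes [measurable]: "g \<in> borel_measurable \<rho>"
  shows "(\<integral>\<^sup>+ y. g y \<partial>\<rho>) = (\<Sum>i\<in>{1..N}. \<integral>\<^sup>+ y. g y * indicator (C i) y \<partial>\<rho>)"
proof -
  have "(\<integral>\<^sup>+ y. g y \<partial>\<rho>) = (\<integral>\<^sup>+ y. (\<Sum>i\<in>{1..N}. g y * indicator (C i) y) \<partial>\<rho>)"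
    using AE_covered
    by (intro nn_integral_cong_AE, eventually_elim)
       (simp only: sum_distrib_left[symmetric] indicator_UN_disjoint[OF _ disjoint_C, symmetric]
         finite_atLeastAtMost indicator_simps mult_1_right)
  also have "\<dots> = (\<Sum>i\<in>{1..N}. \<integral>\<^sup>+ y. g y * indicator (C i) y \<partial>\<rho>)"
    by (rule nn_integral_sum) measurable
  finally show ?thesis .
qed

text \<open>This serves the monotone map, both for the projection and for its competitor, and the map
  that sends each Laguerre cell to its barycenter.\<close>

lemma distr_eq_empirical_measure:
  assumes [measurable]: "S \<in> borel_measurable \<rho>"
    and S: "\<And>i. i \<in> {1..N} \<Longrightarrow> AE y in \<rho>. y \<in> C i \<longrightarrow> S y = z i"
  shows "distr \<rho> borel S = empirical_measure N z"
proof (rule measure_eqI)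
  fix A assume "A \<in> sets (distr \<rho> borel S)"
  then have [measurable]: "A \<in> sets borel" by simp
  have "emeasure (distr \<rho> borel S) A = (\<integral>\<^sup>+ y. indicator A (S y) \<partial>\<rho>)"
    by (subst nn_integral_distr[symmetric, where M'=borel]) auto
  also have "\<dots> = (\<Sum>i\<in>{1..N}. \<integral>\<^sup>+ y. indicator A (S y) * indicator (C i) y \<partial>\<rho>)"
    by (rule nn_integral_cells) measurable
  also have "\<dots> = (\<Sum>i\<in>{1..N}. \<integral>\<^sup>+ y. indicator A (z i) * indicator (C i) y \<partial>\<rho>)"
  proof (intro sum.cong refl nn_integral_cong_AE)
    fix i assume "i \<in> {1..N}"
    from S[OF this] show "AE y in \<rho>. indicator A (S y) * indicator (C i) y = (indicator A (z i) * indicator (C i) y :: ennreal)"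
      by eventually_elim (auto split: split_indicator)
  qed
  also have "\<dots> = (\<Sum>i\<in>{1..N}. ennreal (1 / real N) * indicator A (z i))"
    by (intro sum.cong refl) (subst nn_integral_cmult_indicator, auto simp: mass_C mult.commute)
  finally show "emeasure (distr \<rho> borel S) A = emeasure (empirical_measure N z) A"
    using N by (simp add: emeasure_empirical_measure)
qed simp

end

section \<open>Kantorovich duality for the quadratic cost\<close>

lemma coupling_marginals:
  assumes "\<gamma> \<in> couplings \<mu> \<nu>"
  shows "sets \<gamma> = sets (borel \<Otimes>\<^sub>M borel)" "\<mu> = distr \<gamma> borel fst" "\<nu> = distr \<gamma> borel snd"
  using assms by (auto simp: couplings_def)

text \<open>Since \<open>(x - y)\<^sup>2 = (x\<^sup>2 - 2 * v x) + (y\<^sup>2 - 2 * u y) + 2 * (u y + v x - x * y)\<close>, the cost of a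
  coupling is a constant depending only on the marginals plus twice the integral of the duality
  gap. Finite second moments are enough to make every term integrable. The last claim records that
  the expression is the integral of a square, so the conversion to extended nonnegative
  reals loses nothing.\<close>

lemma coupling_cost:
  assumes \<gamma>: "\<gamma> \<in> couplings \<mu> \<nu>"
    and ix: "integrable \<mu> (\<lambda>x. x\<^sup>2)" and iy: "integrable \<nu> (\<lambda>y. y\<^sup>2)"
    and iv: "integrable \<mu> v" and iu: "integrable \<nu> u"
  defines "D \<equiv> \<lambda>(x, y). u y + v x - x * y"
  shows "integrable \<gamma> D"
    and "(\<integral>\<^sup>+ (x, y). ennreal (\<bar>x - y\<bar>\<^sup>2) \<partial>\<gamma>) =
      ennreal ((\<integral>x. x\<^sup>2 - 2 * v x \<partial>\<mu>) + (\<integral>y. y\<^sup>2 - 2 * u y \<partial>\<nu>) + 2 * (\<integral>p. D p \<partial>\<gamma>))"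
    and "0 \<le> (\<integral>x. x\<^sup>2 - 2 * v x \<partial>\<mu>) + (\<integral>y. y\<^sup>2 - 2 * u y \<partial>\<nu>) + 2 * (\<integral>p. D p \<partial>\<gamma>)"
proof -
  note m = coupling_marginals[OF \<gamma>]
  note [measurable_cong] = m(1)
  have sm: "sets \<mu> = sets borel" "sets \<nu> = sets borel" by (simp_all add: m(2,3))
  have [measurable]: "v \<in> borel_measurable borel" "u \<in> borel_measurable borel"
    using iv iu by (auto dest!: borel_measurable_integrable simp: measurable_cong_sets[OF sm(1) refl]
      measurable_cong_sets[OF sm(2) refl])
  have [measurable]: "fst \<in> measurable \<gamma> borel" "snd \<in> measurable \<gamma> borel" by measurable
  have mu: "integrable \<gamma> (\<lambda>p. h (fst p))" "integral\<^sup>L \<mu> h = (\<integral>p. h (fst p) \<partial>\<gamma>)"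
    if "integrable \<mu> h" "h \<in> borel_measurable borel" for h :: "real \<Rightarrow> real"
    using that unfolding m(2) by (simp_all add: integrable_distr_eq integral_distr)
  have nu: "integrable \<gamma> (\<lambda>p. h (snd p))" "integral\<^sup>L \<nu> h = (\<integral>p. h (snd p) \<partial>\<gamma>)"
    if "integrable \<nu> h" "h \<in> borel_measurable borel" for h :: "real \<Rightarrow> real"
    using that unfolding m(3) by (simp_all add: integrable_distr_eq integral_distr)
  note [simp] = mu(1)[OF ix] mu(1)[OF iv] nu(1)[OF iy] nu(1)[OF iu]
  have [simp]: "integrable \<gamma> (\<lambda>p. fst p * snd p)"
  proof (rule Bochner_Integration.integrable_bound)
    show "integrable \<gamma> (\<lambda>p. (fst p)\<^sup>2 + (snd p)\<^sup>2)" by simp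
    have "\<bar>x * y\<bar> \<le> x\<^sup>2 + y\<^sup>2" for x y :: real
    proof -
      have "2 * (\<bar>x\<bar> * \<bar>y\<bar>) \<le> x\<^sup>2 + y\<^sup>2" using sum_squares_bound[of "\<bar>x\<bar>" "\<bar>y\<bar>"] by simp
      moreover have "0 \<le> \<bar>x\<bar> * \<bar>y\<bar>" by simp
      ultimately show ?thesis unfolding abs_mult by linarith
    qed
    then show "AE p in \<gamma>. norm (fst p * snd p) \<le> norm ((fst p)\<^sup>2 + (snd p)\<^sup>2)" by simp
  qed measurable
  show iD: "integrable \<gamma> D" unfolding D_def case_prod_beta by simp
  let ?K = "(\<integral>x. x\<^sup>2 - 2 * v x \<partial>\<mu>) + (\<integral>y. y\<^sup>2 - 2 * u y \<partial>\<nu>) + 2 * (\<integral>p. D p \<partial>\<gamma>)"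
  have "(\<integral>p. (fst p - snd p)\<^sup>2 \<partial>\<gamma>) =
      (\<integral>p. ((fst p)\<^sup>2 - 2 * v (fst p)) + ((snd p)\<^sup>2 - 2 * u (snd p)) + 2 * D p \<partial>\<gamma>)"
    by (intro Bochner_Integration.integral_cong) (auto simp: D_def power2_diff algebra_simps)
  also have "\<dots> = (\<integral>p. (fst p)\<^sup>2 - 2 * v (fst p) \<partial>\<gamma>) + (\<integral>p. (snd p)\<^sup>2 - 2 * u (snd p) \<partial>\<gamma>)
      + 2 * (\<integral>p. D p \<partial>\<gamma>)"
    using iD by simp
  also have "(\<integral>p. (fst p)\<^sup>2 - 2 * v (fst p) \<partial>\<gamma>) = (\<integral>x. x\<^sup>2 - 2 * v x \<partial>\<mu>)"
    using ix iv by (intro mu(2)[symmetric]) auto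
  also have "(\<integral>p. (snd p)\<^sup>2 - 2 * u (snd p) \<partial>\<gamma>) = (\<integral>y. y\<^sup>2 - 2 * u y \<partial>\<nu>)"
    using iy iu by (intro nu(2)[symmetric]) auto
  finally have K: "(\<integral>p. (fst p - snd p)\<^sup>2 \<partial>\<gamma>) = ?K" .
  show "0 \<le> ?K" unfolding K[symmetric] by simp
  have "(\<integral>\<^sup>+ (x, y). ennreal (\<bar>x - y\<bar>\<^sup>2) \<partial>\<gamma>) = (\<integral>\<^sup>+ p. ennreal ((fst p - snd p)\<^sup>2) \<partial>\<gamma>)"
    by (simp add: case_prod_beta')
  also have "\<dots> = ennreal (\<integral>p. (fst p - snd p)\<^sup>2 \<partial>\<gamma>)"
  proof (rule nn_integral_eq_integral)
    show "integrable \<gamma> (\<lambda>p. (fst p - snd p)\<^sup>2)" by (simp add: power2_diff mult.assoc)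
  qed simp
  finally show "(\<integral>\<^sup>+ (x, y). ennreal (\<bar>x - y\<bar>\<^sup>2) \<partial>\<gamma>) = ennreal ?K" unfolding K .
qed

lemma transport_map_coupling:
  assumes S: "S \<in> transport_maps \<nu> \<mu>" and s: "sets \<nu> = sets borel"
  defines "\<gamma> \<equiv> distr \<nu> (borel \<Otimes>\<^sub>M borel) (\<lambda>y. (S y, y))"
  shows "\<gamma> \<in> couplings \<mu> \<nu>"
    and "(\<integral>\<^sup>+ (x, y). ennreal (\<bar>x - y\<bar>\<^sup>2) \<partial>\<gamma>) = (\<integral>\<^sup>+ y. ennreal (\<bar>y - S y\<bar>\<^sup>2) \<partial>\<nu>)"
proof -
  note [measurable_cong] = s
  have [measurable]: "S \<in> borel_measurable borel" and d: "distr \<nu> borel S = \<mu>"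
    using S by (auto simp: transport_maps_def)
  have "distr \<nu> borel (\<lambda>y. y) = \<nu>" using s by (intro distr_id2) simp
  then show "\<gamma> \<in> couplings \<mu> \<nu>"
    unfolding couplings_def \<gamma>_def using d by (auto simp: distr_distr comp_def)
  show "(\<integral>\<^sup>+ (x, y). ennreal (\<bar>x - y\<bar>\<^sup>2) \<partial>\<gamma>) = (\<integral>\<^sup>+ y. ennreal (\<bar>y - S y\<bar>\<^sup>2) \<partial>\<nu>)"
    unfolding \<gamma>_def by (subst nn_integral_distr) (auto simp: power2_commute)
qed

lemma W2_sq_le_transport_cost:
  assumes "S \<in> transport_maps \<nu> \<mu>" "sets \<nu> = sets borel"
  shows "W2_sq \<mu> \<nu> \<le> (\<integral>\<^sup>+ y. ennreal (\<bar>y - S y\<bar>\<^sup>2) \<partial>\<nu>)"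
  unfolding W2_sq_def transport_map_coupling(2)[OF assms, symmetric]
  by (intro INF_lower transport_map_coupling(1) assms)

lemma couplings_sym:
  assumes "\<gamma> \<in> couplings \<mu> \<nu>"
  shows "distr \<gamma> (borel \<Otimes>\<^sub>M borel) (\<lambda>(x, y). (y, x)) \<in> couplings \<nu> \<mu>"
proof -
  note m = coupling_marginals[OF assms]
  note [measurable_cong] = m(1)
  show ?thesis unfolding couplings_def m(2,3)
    by (auto simp: distr_distr comp_def case_prod_beta intro!: distr_cong)
qed

lemma W2_sq_commute: "W2_sq \<mu> \<nu> = W2_sq \<nu> \<mu>"
proof -
  have "W2_sq \<nu> \<mu> \<le> W2_sq \<mu> \<nu>" for \<mu> \<nu>
    unfolding W2_sq_def
  proof (rule INF_mono)
    fix \<gamma> assume \<gamma>: "\<gamma> \<in> couplings \<mu> \<nu>"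
    note [measurable_cong] = coupling_marginals(1)[OF \<gamma>]
    let ?\<gamma> = "distr \<gamma> (borel \<Otimes>\<^sub>M borel) (\<lambda>(x, y). (y, x))"
    have "(\<integral>\<^sup>+ (x, y). ennreal (\<bar>x - y\<bar>\<^sup>2) \<partial>?\<gamma>) = (\<integral>\<^sup>+ (x, y). ennreal (\<bar>x - y\<bar>\<^sup>2) \<partial>\<gamma>)"
      by (subst nn_integral_distr) (auto simp: case_prod_beta' power2_commute)
    with couplings_sym[OF \<gamma>] show "\<exists>\<gamma>'\<in>couplings \<nu> \<mu>. (\<integral>\<^sup>+ (x, y). ennreal (\<bar>x - y\<bar>\<^sup>2) \<partial>\<gamma>') \<le>
        (\<integral>\<^sup>+ (x, y). ennreal (\<bar>x - y\<bar>\<^sup>2) \<partial>\<gamma>)"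
      by (metis order_refl)
  qed
  then show ?thesis by (intro antisym)
qed

text \<open>Kantorovich duality in the direction that is needed: when the gap \<open>u y + v x - x * y\<close> is
  nonnegative and vanishes on the graph of \<open>S\<close>, the cost of \<open>S\<close> is the constant part of
  \<open>coupling_cost\<close>, so \<open>S\<close> is optimal even among couplings. Any other optimal map must then have gap
  of integral zero, so its graph lies in the contact set as well.\<close>

lemma contact_map_optimal:
  assumes s: "sets \<nu> = sets borel"
    and i: "integrable \<mu> (\<lambda>x. x\<^sup>2)" "integrable \<nu> (\<lambda>y. y\<^sup>2)" "integrable \<mu> v" "integrable \<nu> u"
    and young: "AE x in \<mu>. \<forall>y. x * y \<le> u y + v x"
    and S: "S \<in> transport_maps \<nu> \<mu>"
    and contact: "AE y in \<nu>. S y * y = u y + v (S y)"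
  shows "W2_sq \<mu> \<nu> = (\<integral>\<^sup>+ y. ennreal (\<bar>y - S y\<bar>\<^sup>2) \<partial>\<nu>)"
    and "\<And>T. is_optimal_transport_map \<nu> \<mu> T \<Longrightarrow> AE y in \<nu>. T y * y = u y + v (T y)"
proof -
  \<comment> \<open>the part of the cost that all couplings share\<close>
  define K where "K = (\<integral>x. x\<^sup>2 - 2 * v x \<partial>\<mu>) + (\<integral>y. y\<^sup>2 - 2 * u y \<partial>\<nu>)"
  define D where "D = (\<lambda>(x, y). u y + v x - x * y)"
  note [measurable_cong] = s
  have graph: "(\<integral>p. D p \<partial>(distr \<nu> (borel \<Otimes>\<^sub>M borel) (\<lambda>y. (R y, y)))) = (\<integral>y. D (R y, y) \<partial>\<nu>)"
    and graph_int: "integrable \<nu> (\<lambda>y. D (R y, y))"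
    and graph_cost: "(\<integral>\<^sup>+ y. ennreal (\<bar>y - R y\<bar>\<^sup>2) \<partial>\<nu>) = ennreal (K + 2 * (\<integral>y. D (R y, y) \<partial>\<nu>))"
    and graph_K: "0 \<le> K + 2 * (\<integral>y. D (R y, y) \<partial>\<nu>)"
    and graph_nonneg: "AE y in \<nu>. 0 \<le> D (R y, y)"
    if R: "R \<in> transport_maps \<nu> \<mu>" for R
  proof -
    have [measurable]: "R \<in> borel_measurable borel" and d: "distr \<nu> borel R = \<mu>"
      using R by (auto simp: transport_maps_def)
    have sm: "sets \<mu> = sets borel" unfolding d[symmetric] by simp
    have [measurable]: "v \<in> borel_measurable borel" "u \<in> borel_measurable borel"
      using i(3,4) by (auto dest!: borel_measurable_integrable simp: measurable_cong_sets[OF sm refl]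
        measurable_cong_sets[OF s refl])
    have [measurable]: "D \<in> borel_measurable (borel \<Otimes>\<^sub>M borel)" unfolding D_def by measurable
    note c = coupling_cost[OF transport_map_coupling(1)[OF R s] i, folded D_def]
    show g: "(\<integral>p. D p \<partial>(distr \<nu> (borel \<Otimes>\<^sub>M borel) (\<lambda>y. (R y, y)))) = (\<integral>y. D (R y, y) \<partial>\<nu>)"
      by (rule integral_distr) measurable
    show "integrable \<nu> (\<lambda>y. D (R y, y))"
      using c(1) by (subst (asm) integrable_distr_eq) auto
    show "(\<integral>\<^sup>+ y. ennreal (\<bar>y - R y\<bar>\<^sup>2) \<partial>\<nu>) = ennreal (K + 2 * (\<integral>y. D (R y, y) \<partial>\<nu>))"
      using c(2) unfolding transport_map_coupling(2)[OF R s] g K_def .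
    show "0 \<le> K + 2 * (\<integral>y. D (R y, y) \<partial>\<nu>)" using c(3) unfolding g K_def .
    have "AE y in \<nu>. \<forall>y'. R y * y' \<le> u y' + v (R y)"
      using young unfolding d[symmetric] by (rule AE_distrD[rotated]) measurable
    then show "AE y in \<nu>. 0 \<le> D (R y, y)" by eventually_elim (auto simp: D_def)
  qed
  have "(\<integral>y. D (S y, y) \<partial>\<nu>) = (\<integral>y. 0 \<partial>\<nu>)"
    using graph_int[OF S] contact
    by (intro integral_cong_AE borel_measurable_integrable) (auto simp: D_def elim!: eventually_mono)
  then have S_cost: "(\<integral>\<^sup>+ y. ennreal (\<bar>y - S y\<bar>\<^sup>2) \<partial>\<nu>) = ennreal K" and K: "0 \<le> K"
    using graph_cost[OF S] graph_K[OF S] by simp_all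
  have "ennreal K \<le> W2_sq \<mu> \<nu>" unfolding W2_sq_def
  proof (rule INF_greatest)
    fix \<gamma> assume \<gamma>: "\<gamma> \<in> couplings \<mu> \<nu>"
    note [measurable_cong] = coupling_marginals(1)[OF \<gamma>]
    have "AE p in \<gamma>. \<forall>y. fst p * y \<le> u y + v (fst p)"
      using young unfolding coupling_marginals(2)[OF \<gamma>] by (rule AE_distrD[rotated]) measurable
    then have "AE p in \<gamma>. 0 \<le> D p" by eventually_elim (auto simp: D_def case_prod_beta)
    then have "0 \<le> (\<integral>p. D p \<partial>\<gamma>)" by (rule integral_nonneg_AE)
    then show "ennreal K \<le> (\<integral>\<^sup>+ (x, y). ennreal (\<bar>x - y\<bar>\<^sup>2) \<partial>\<gamma>)"
      unfolding coupling_cost(2)[OF \<gamma> i, folded D_def K_def] by (intro ennreal_leI) simp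
  qed
  with W2_sq_le_transport_cost[OF S s]
  show "W2_sq \<mu> \<nu> = (\<integral>\<^sup>+ y. ennreal (\<bar>y - S y\<bar>\<^sup>2) \<partial>\<nu>)" unfolding S_cost by (rule antisym)
  show "AE y in \<nu>. T y * y = u y + v (T y)" if "is_optimal_transport_map \<nu> \<mu> T" for T
  proof -
    have T: "T \<in> transport_maps \<nu> \<mu>"
      and le: "(\<integral>\<^sup>+ y. ennreal (\<bar>y - T y\<bar>\<^sup>2) \<partial>\<nu>) \<le> (\<integral>\<^sup>+ y. ennreal (\<bar>y - S y\<bar>\<^sup>2) \<partial>\<nu>)"
      using that S unfolding is_optimal_transport_map_def is_arg_min_def by (auto simp: not_less)
    have "0 \<le> (\<integral>y. D (T y, y) \<partial>\<nu>)" by (rule integral_nonneg_AE[OF graph_nonneg[OF T]])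
    then have "(\<integral>y. D (T y, y) \<partial>\<nu>) = 0"
      using le K unfolding S_cost graph_cost[OF T] by (subst (asm) ennreal_le_iff) auto
    then have "AE y in \<nu>. D (T y, y) = 0"
      using integral_nonneg_eq_0_iff_AE[OF graph_int[OF T] graph_nonneg[OF T]] by simp
    then show ?thesis by eventually_elim (auto simp: D_def)
  qed
qed

section \<open>The monotone map to a finite set and its dual potentials\<close>

text \<open>The increasing points \<open>z 1, \<dots>, z N\<close> are the targets, the increasing numbers
  \<open>q 0, \<dots>, q N\<close> the ends of the cells. Only the inner ones, \<open>q 1, \<dots>, q (N - 1)\<close>, are jumps of
  the monotone map; \<open>q 0\<close> and \<open>q N\<close> bound the outer cells.\<close>

locale monotone_steps =
  fixes N :: nat and z q :: "nat \<Rightarrow> real"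
  assumes N: "N \<ge> 1"
    and z: "strict_mono_on {1..N} z"
    and q: "strict_mono_on {..N} q"
begin

definition cell :: "nat \<Rightarrow> real set" where
  "cell k = {q (k - 1)<..<q k}"

definition step_map :: "real \<Rightarrow> real" where
  "step_map y = z 1 + (\<Sum>m\<in>{1..<N}. (z (Suc m) - z m) * indicator {q m<..} y)"

text \<open>Writing a target as \<open>t = z 1 + (\<Sum>m. (z (Suc m) - z m) * [t \<ge> z (Suc m)])\<close> turns the
  quantity \<open>t * y - target_potential t\<close> into \<open>z 1 * y\<close> plus a sum of independent binary choices: each
  term \<open>(z (Suc m) - z m) * (y - q m)\<close> is either taken or left out. The best choice takes it exactly
  when \<open>y > q m\<close>, which defines both \<open>step_map\<close> and the source potential, the convex conjugate of
  the target potential.\<close>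

definition target_potential :: "real \<Rightarrow> real" where
  "target_potential t = (\<Sum>m\<in>{1..<N}. (z (Suc m) - z m) * q m * indicator {z (Suc m)..} t)"

definition source_potential :: "real \<Rightarrow> real" where
  "source_potential y = z 1 * y + (\<Sum>m\<in>{1..<N}. (z (Suc m) - z m) * max 0 (y - q m))"

lemma gap_pos: "m \<in> {1..<N} \<Longrightarrow> 0 < z (Suc m) - z m"
  using z by (auto simp: strict_mono_on_def)

lemma z_le_iff: "i \<in> {1..N} \<Longrightarrow> j \<in> {1..N} \<Longrightarrow> z i \<le> z j \<longleftrightarrow> i \<le> j"
  using z by (metis strict_mono_on_less_eq)

lemma q_le_iff: "i \<le> N \<Longrightarrow> j \<le> N \<Longrightarrow> q i \<le> q j \<longleftrightarrow> i \<le> j"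
  using q by (metis strict_mono_on_less_eq atMost_iff)

lemma z_telescope:
  assumes "k \<in> {1..N}"
  shows "z k = z 1 + (\<Sum>m\<in>{1..<N}. (z (Suc m) - z m) * of_bool (m < k))"
proof -
  have "(\<Sum>m\<in>{1..<N}. (z (Suc m) - z m) * of_bool (m < k)) = (\<Sum>m\<in>{1..<k}. z (Suc m) - z m)"
    using assms by (intro sum.mono_neutral_cong_right) auto
  also have "\<dots> = z k - z 1" using assms by (intro sum_Suc_diff') auto
  finally show ?thesis by simp
qed

lemma cell_above_iff:
  assumes "k \<in> {1..N}" "y \<in> cell k" "m \<in> {1..<N}"
  shows "q m < y \<longleftrightarrow> m < k" "y \<noteq> q m"
proof -
  have *: "q (k - 1) < y" "y < q k" using assms by (auto simp: cell_def)
  have "q m \<le> q (k - 1)" if "m < k" using that assms by (subst q_le_iff) auto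
  moreover have "q k \<le> q m" if "\<not> m < k" using that assms by (subst q_le_iff) auto
  ultimately show "q m < y \<longleftrightarrow> m < k" "y \<noteq> q m" using * by force+
qed

lemma step_map_cell:
  assumes "k \<in> {1..N}" "y \<in> cell k"
  shows "step_map y = z k"
  unfolding step_map_def z_telescope[OF assms(1)]
  using cell_above_iff[OF assms]
  by (intro arg_cong2[where f="(+)"] sum.cong) (auto simp: indicator_def)

lemma disjoint_cells: "disjoint_family_on cell {1..N}"
proof -
  have "k = j" if "k \<in> {1..N}" "j \<in> {1..N}" "y \<in> cell k" "y \<in> cell j" for j k y
    using step_map_cell that z_le_iff by (metis order_antisym order_refl)
  then show ?thesis by (auto simp: disjoint_family_on_def)
qed

lemma cell_borel [measurable]: "cell k \<in> sets borel"
  by (simp add: cell_def)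

lemma step_map_measurable [measurable]: "step_map \<in> borel_measurable borel"
  unfolding step_map_def[abs_def] by measurable

lemma target_potential_measurable [measurable]: "target_potential \<in> borel_measurable borel"
  unfolding target_potential_def[abs_def] by measurable

lemma continuous_source_potential: "continuous_on A source_potential"
  unfolding source_potential_def[abs_def] by (intro continuous_intros)

text \<open>By the layer decomposition the duality gap is a sum of one nonnegative loss per jump, the
  loss of taking the term \<open>y - q m\<close> or leaving it out compared with its positive part.\<close>

lemma duality_gap:
  assumes "k \<in> {1..N}"
  shows "source_potential y + target_potential (z k) - z k * y =
    (\<Sum>m\<in>{1..<N}. (z (Suc m) - z m) * (max 0 (y - q m) - of_bool (m < k) * (y - q m)))"
proof -
  have "target_potential (z k) = (\<Sum>m\<in>{1..<N}. (z (Suc m) - z m) * q m * of_bool (m < k))"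
    unfolding target_potential_def using assms z_le_iff
    by (intro sum.cong) (auto simp: indicator_def)
  moreover have "z k * y = z 1 * y + (\<Sum>m\<in>{1..<N}. (z (Suc m) - z m) * of_bool (m < k) * y)"
    by (subst z_telescope[OF assms]) (simp only: distrib_right sum_distrib_right)
  moreover have "(\<Sum>m\<in>{1..<N}. (z (Suc m) - z m) * (max 0 (y - q m) - of_bool (m < k) * (y - q m))) =
      (\<Sum>m\<in>{1..<N}. (z (Suc m) - z m) * max 0 (y - q m))
      + (\<Sum>m\<in>{1..<N}. (z (Suc m) - z m) * q m * of_bool (m < k))
      - (\<Sum>m\<in>{1..<N}. (z (Suc m) - z m) * of_bool (m < k) * y)"
    unfolding sum.distrib[symmetric] sum_subtractf[symmetric]
    by (intro sum.cong) (auto simp: algebra_simps)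
  ultimately show ?thesis unfolding source_potential_def by linarith
qed

lemma young_inequality:
  assumes "k \<in> {1..N}"
  shows "z k * y \<le> source_potential y + target_potential (z k)"
proof -
  have "0 \<le> source_potential y + target_potential (z k) - z k * y"
    unfolding duality_gap[OF assms] using gap_pos
    by (intro sum_nonneg mult_nonneg_nonneg) (auto intro: less_imp_le)
  then show ?thesis by simp
qed

text \<open>The gap vanishes only if every one of the binary choices is the right one, and in the
  interior of a cell no choice is a tie. This makes the optimal map unique almost everywhere.\<close>

lemma contact_iff:
  assumes "k \<in> {1..N}" "j \<in> {1..N}" "y \<in> cell j"
  shows "z k * y = source_potential y + target_potential (z k) \<longleftrightarrow> k = j"
proof -
  have "z k * y = source_potential y + target_potential (z k) \<longleftrightarrow>
    (\<Sum>m\<in>{1..<N}. (z (Suc m) - z m) * (max 0 (y - q m) - of_bool (m < k) * (y - q m))) = 0"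
    unfolding duality_gap[OF assms(1), symmetric] by auto
  also have "\<dots> \<longleftrightarrow> (\<forall>m\<in>{1..<N}. (z (Suc m) - z m) * (max 0 (y - q m) - of_bool (m < k) * (y - q m)) = 0)"
    using gap_pos by (intro sum_nonneg_eq_0_iff ballI mult_nonneg_nonneg) (auto intro: less_imp_le)
  also have "\<dots> \<longleftrightarrow> (\<forall>m\<in>{1..<N}. m < j \<longleftrightarrow> m < k)"
  proof (intro ball_cong refl)
    fix m assume m: "m \<in> {1..<N}"
    show "(z (Suc m) - z m) * (max 0 (y - q m) - of_bool (m < k) * (y - q m)) = 0 \<longleftrightarrow> (m < j \<longleftrightarrow> m < k)"
      using gap_pos[OF m] cell_above_iff[OF assms(2,3) m] by (auto simp: max_def)
  qed
  also have "\<dots> \<longleftrightarrow> k = j"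
  proof (intro iffI)
    assume *: "\<forall>m\<in>{1..<N}. m < j \<longleftrightarrow> m < k"
    have "\<not> k < j" using * assms by (auto dest: bspec[of _ _ k])
    moreover have "\<not> j < k" using * assms by (auto dest: bspec[of _ _ j])
    ultimately show "k = j" by simp
  qed simp
  finally show ?thesis .
qed

end

section \<open>Minimal second moment under a density constraint\<close>

text \<open>Passing to a real density with values in \<open>[0, 1]\<close> everywhere, by truncation on a null set.\<close>

lemma density_le_one_real:
  assumes "density_le_one \<sigma>"
  obtains f :: "real \<Rightarrow> real" where "f \<in> borel_measurable borel" "\<And>y. 0 \<le> f y" "\<And>y. f y \<le> 1"
    "\<sigma> = density lborel (\<lambda>y. ennreal (f y))"
proof -
  obtain g where [measurable]: "g \<in> borel_measurable lborel"
    and g: "\<sigma> = density lborel g" "AE y in lborel. g y \<le> 1"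
    using assms by (auto simp: density_le_one_def)
  have le: "min 1 (g y) < top" for y by (auto simp: min_less_iff_disj)
  show ?thesis
  proof (rule that[of "\<lambda>y. enn2real (min 1 (g y))"])
    show "enn2real (min 1 (g y)) \<le> 1" for y by (rule enn2real_leI) auto
    show "\<sigma> = density lborel (\<lambda>y. ennreal (enn2real (min 1 (g y))))"
      unfolding g(1) using g(2) le
      by (intro density_cong) (auto simp: min_absorb2 elim!: eventually_mono)
  qed auto
qed

text \<open>Among the densities with values in \<open>[0, 1]\<close> and mass \<open>m\<close> on an interval, the second moment
  about \<open>t\<close> is smallest for the indicator of the subinterval \<open>J\<close> of length \<open>m\<close> that lies closest to
  \<open>t\<close>, and up to null sets for no other density. The reason is that \<open>(y - t)\<^sup>2\<close> is at most some level \<open>l\<close> on \<open>J\<close> and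
  at least \<open>l\<close> off \<open>J\<close>: moving mass from outside \<open>J\<close> into the room left inside can only lower the
  moment.\<close>

lemma bathtub:
  fixes f :: "real \<Rightarrow> real" and p r m t :: real
  assumes [measurable]: "f \<in> borel_measurable borel" and f0: "\<And>y. 0 \<le> f y" and f1: "\<And>y. f y \<le> 1"
    and m: "0 < m" and mass: "(\<integral>\<^sup>+ y. ennreal (f y) * indicator {p<..<r} y \<partial>lborel) = ennreal m"
  obtains c A B where "{c<..<c + m} \<subseteq> {p<..<r}"
    "(\<integral>\<^sup>+ y. ennreal (\<bar>y - t\<bar>\<^sup>2) * indicator {c<..<c + m} y \<partial>lborel) = ennreal A" "0 \<le> A"
    "(\<integral>\<^sup>+ y. ennreal (\<bar>y - t\<bar>\<^sup>2) * (ennreal (f y) * indicator {p<..<r} y) \<partial>lborel) = ennreal B" "A \<le> B"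
    "B = A \<Longrightarrow> AE y in lborel. f y * indicator {p<..<r} y = indicator {c<..<c + m} y"
proof -
  have pr: "p < r"
  proof (rule ccontr)
    assume "\<not> p < r"
    then have "{p<..<r} = {}" by auto
    with mass m show False by simp
  qed
  have "ennreal m \<le> (\<integral>\<^sup>+ y. indicator {p<..<r} y \<partial>lborel)"
    unfolding mass[symmetric] using f1 by (intro nn_integral_mono) (auto split: split_indicator)
  then have mle: "m \<le> r - p" using pr by simp
  \<comment> \<open>the interval of length \<open>m\<close> centred at \<open>t\<close>, pushed back into \<open>(p, r)\<close> if it sticks out\<close>
  define c where "c = max p (min (r - m) (t - m / 2))"
  define J where "J = {c<..<c + m}"
  define l where "l = max ((c - t)\<^sup>2) ((c + m - t)\<^sup>2)"
  have J_sub: "J \<subseteq> {p<..<r}" using mle unfolding J_def c_def by auto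
  have [measurable]: "J \<in> sets borel" by (simp add: J_def)
  have inside: "(y - t)\<^sup>2 \<le> l" if "y \<in> J" for y
  proof -
    have "\<bar>y - t\<bar> \<le> \<bar>c - t\<bar> \<or> \<bar>y - t\<bar> \<le> \<bar>c + m - t\<bar>"
      using that unfolding J_def by auto
    then show ?thesis unfolding l_def by (auto simp: abs_le_square_iff le_max_iff_disj)
  qed
  have outside: "l \<le> (y - t)\<^sup>2" if "y \<in> {p<..<r}" "y \<notin> J" for y
  proof -
    have "\<bar>c - t\<bar> \<le> \<bar>y - t\<bar> \<and> \<bar>c + m - t\<bar> \<le> \<bar>y - t\<bar>"
      using that m mle unfolding J_def c_def by (auto simp: max_def min_def abs_if split: if_splits)
    then show ?thesis unfolding l_def by (simp add: abs_le_square_iff)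
  qed
  define g where "g = (\<lambda>y. f y * indicator {p<..<r} y)"
  have [measurable]: "g \<in> borel_measurable borel" unfolding g_def by measurable
  have g0: "0 \<le> g y" and g1: "g y \<le> 1" and gout: "y \<notin> {p<..<r} \<Longrightarrow> g y = 0" for y
    using f0 f1 by (auto simp: g_def split: split_indicator)
  have int: "integrable lborel (\<lambda>y. h y * w y)"
    if "continuous_on UNIV h" "w \<in> borel_measurable borel" "\<And>y. \<bar>w y\<bar> \<le> 1"
      "\<And>y. y \<notin> {p<..<r} \<Longrightarrow> w y = 0" for h w :: "real \<Rightarrow> real"
  proof -
    have "bounded (h ` {p..r})"
      by (intro compact_imp_bounded compact_continuous_image continuous_on_subset[OF that(1)]) auto
    then obtain b where b: "\<And>y. y \<in> {p..r} \<Longrightarrow> \<bar>h y\<bar> \<le> b" unfolding bounded_iff by (metis imageI real_norm_def)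
    have [measurable]: "h \<in> borel_measurable borel"
      using that(1) by (rule borel_measurable_continuous_onI)
    note [measurable] = that(2)
    show ?thesis
    proof (rule integrableI_bounded_set[where A="{p<..<r}" and B=b])
      show "AE y in lborel. y \<in> {p<..<r} \<longrightarrow> norm (h y * w y) \<le> b"
      proof (intro AE_I2 impI)
        fix y assume "y \<in> {p<..<r}"
        then have "\<bar>h y\<bar> \<le> b" using b by auto
        then show "norm (h y * w y) \<le> b"
          using that(3)[of y] mult_mono[of "\<bar>h y\<bar>" b "\<bar>w y\<bar>" 1] by (simp add: abs_mult)
      qed
    qed (use that(4) pr in auto)
  qed
  have intg: "integrable lborel (\<lambda>y. h y * g y)" if "continuous_on UNIV h" for h
    using g0 g1 gout by (intro int that) (auto simp: abs_le_iff)
  have intJ: "integrable lborel (\<lambda>y. h y * indicator J y)" if "continuous_on UNIV h" for h :: "real \<Rightarrow> real"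
    using J_sub by (intro int that) (auto simp: indicator_def)
  note sq = continuous_on_power[OF continuous_on_diff[OF continuous_on_id continuous_on_const], of UNIV t 2]
  define A where "A = (\<integral>y. (y - t)\<^sup>2 * indicator J y \<partial>lborel)"
  define B where "B = (\<integral>y. (y - t)\<^sup>2 * g y \<partial>lborel)"
  have costJ: "(\<integral>\<^sup>+ y. ennreal (\<bar>y - t\<bar>\<^sup>2) * indicator J y \<partial>lborel) = ennreal A"
  proof -
    have "(\<integral>\<^sup>+ y. ennreal (\<bar>y - t\<bar>\<^sup>2) * indicator J y \<partial>lborel) = (\<integral>\<^sup>+ y. ennreal ((y - t)\<^sup>2 * indicator J y) \<partial>lborel)"
      by (intro nn_integral_cong) (auto split: split_indicator)
    then show ?thesis unfolding A_def using intJ[OF sq] by (subst (asm) nn_integral_eq_integral) auto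
  qed
  have costg: "(\<integral>\<^sup>+ y. ennreal (\<bar>y - t\<bar>\<^sup>2) * (ennreal (f y) * indicator {p<..<r} y) \<partial>lborel) = ennreal B"
  proof -
    have "(\<integral>\<^sup>+ y. ennreal (\<bar>y - t\<bar>\<^sup>2) * (ennreal (f y) * indicator {p<..<r} y) \<partial>lborel)
        = (\<integral>\<^sup>+ y. ennreal ((y - t)\<^sup>2 * g y) \<partial>lborel)"
      using f0 by (intro nn_integral_cong) (auto simp: g_def ennreal_mult split: split_indicator)
    then show ?thesis unfolding B_def using intg[OF sq] g0 by (subst (asm) nn_integral_eq_integral) auto
  qed
  have "ennreal (\<integral>y. g y \<partial>lborel) = ennreal m"
    using intg[of "\<lambda>_. 1"] g0 unfolding mass[symmetric]
    by (subst nn_integral_eq_integral[symmetric])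
       (auto simp: g_def ennreal_mult intro!: nn_integral_cong split: split_indicator)
  then have massg: "(\<integral>y. g y \<partial>lborel) = m"
    using m g0 by (subst (asm) ennreal_inj) (auto intro: integral_nonneg_AE)
  have massJ: "(\<integral>y. indicator J y \<partial>lborel) = m" using m by (simp add: J_def)
  \<comment> \<open>\<open>B - A\<close> is the integral of \<open>((y - t)\<^sup>2 - l) * (g y - indicator J y)\<close>, because the two densities
    have the same mass; the integrand is nonnegative on \<open>J\<close> and off \<open>J\<close>\<close>
  let ?h = "\<lambda>y. ((y - t)\<^sup>2 - l) * g y - ((y - t)\<^sup>2 - l) * indicator J y"
  note i1 = intg[OF sq] intJ[OF sq] intg[of "\<lambda>_. l"] intJ[of "\<lambda>_. l"]
  have inth: "integrable lborel ?h" using i1 by (simp add: left_diff_distrib)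
  have "(\<integral>y. ?h y \<partial>lborel) = (B - l * m) - (A - l * m)"
    using i1 massg massJ unfolding A_def B_def by (simp add: left_diff_distrib)
  then have inth_eq: "(\<integral>y. ?h y \<partial>lborel) = B - A" by simp
  have h0: "0 \<le> ?h y" for y
  proof (cases "y \<in> J")
    case True
    then have "?h y = (l - (y - t)\<^sup>2) * (1 - g y)" by (simp add: algebra_simps)
    with inside[OF True] g1[of y] show ?thesis by (simp add: mult_nonneg_nonneg)
  next
    case False
    then show ?thesis using outside[of y] g0[of y] gout[of y] by (cases "y \<in> {p<..<r}") auto
  qed
  have "0 \<le> (\<integral>y. ?h y \<partial>lborel)" using h0 by (intro integral_nonneg_AE) auto
  then have AB: "A \<le> B" unfolding inth_eq by simp
  have A0: "0 \<le> A" unfolding A_def by (intro integral_nonneg_AE) auto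
  have eq: "AE y in lborel. f y * indicator {p<..<r} y = indicator J y" if "B = A"
  proof -
    have "(\<integral>y. ?h y \<partial>lborel) = 0" using that inth_eq by simp
    then have "AE y in lborel. ?h y = 0"
      using integral_nonneg_eq_0_iff_AE[OF inth] h0 by auto
    \<comment> \<open>the level set \<open>(y - t)\<^sup>2 = l\<close> is the only place where the integrand could vanish without
      equality of the densities, and it is null\<close>
    moreover have "AE y in lborel. y \<noteq> t + sqrt l" "AE y in lborel. y \<noteq> t - sqrt l"
      by (rule AE_lborel_singleton)+
    ultimately show ?thesis
    proof eventually_elim
      case (elim y)
      have "(y - t)\<^sup>2 \<noteq> l"
      proof
        assume "(y - t)\<^sup>2 = l"
        then have "sqrt l = \<bar>y - t\<bar>" by (metis real_sqrt_abs)
        with elim(2,3) show False by (auto simp: abs_if split: if_splits)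
      qed
      with elim(1) have "g y = indicator J y" by (simp add: left_diff_distrib[symmetric] right_diff_distrib[symmetric])
      then show ?case by (simp add: g_def)
    qed
  qed
  show ?thesis
    using J_sub costJ A0 costg AB eq unfolding J_def by (rule that)
qed

section \<open>Optimality of the monotone map\<close>

lemma integrable_continuous_bounded_support:
  assumes "prob_space \<sigma>" and s: "sets \<sigma> = sets borel" and mass: "emeasure \<sigma> {a..b::real} = 1"
    and h: "continuous_on UNIV (h :: real \<Rightarrow> real)"
  shows "integrable \<sigma> h"
proof -
  interpret prob_space \<sigma> by fact
  have "bounded (h ` {a..b})"
    by (intro compact_imp_bounded compact_continuous_image continuous_on_subset[OF h]) auto
  then obtain B where B: "\<And>y. y \<in> {a..b} \<Longrightarrow> \<bar>h y\<bar> \<le> B"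
    unfolding bounded_iff by (metis imageI real_norm_def)
  have "AE y in \<sigma>. y \<in> {a..b}"
    using mass by (intro AE_prob_1) (simp add: measure_def)
  then have "AE y in \<sigma>. norm (h y) \<le> B" by eventually_elim (use B in auto)
  moreover have "h \<in> borel_measurable \<sigma>"
    using borel_measurable_continuous_onI[OF h] by (simp add: measurable_cong_sets[OF s refl])
  ultimately show ?thesis by (rule integrable_const_bound)
qed

lemma integrable_empirical_measure:
  assumes "h \<in> borel_measurable borel"
  shows "integrable (empirical_measure N z) (h :: real \<Rightarrow> real)"
  unfolding empirical_measure_def uniform_count_measure_def
  using assms by (subst integrable_distr_eq) (auto intro!: integrable_point_measure_finite)

context monotone_steps
begin

lemma step_map_transports:
  assumes "equal_cells \<rho> N cell" and s: "sets \<rho> = sets borel"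
  shows "step_map \<in> transport_maps \<rho> (empirical_measure N z)"
    and "(\<integral>\<^sup>+ y. ennreal (\<bar>y - step_map y\<bar>\<^sup>2) \<partial>\<rho>) =
      (\<Sum>k\<in>{1..N}. \<integral>\<^sup>+ y. ennreal (\<bar>y - z k\<bar>\<^sup>2) * indicator (cell k) y \<partial>\<rho>)"
proof -
  interpret R: equal_cells \<rho> N cell by fact
  note [measurable_cong] = s
  have "distr \<rho> borel step_map = empirical_measure N z"
    using step_map_cell by (intro R.distr_eq_empirical_measure) auto
  then show "step_map \<in> transport_maps \<rho> (empirical_measure N z)"
    by (simp add: transport_maps_def)
  have "(\<integral>\<^sup>+ y. ennreal (\<bar>y - step_map y\<bar>\<^sup>2) \<partial>\<rho>) =
      (\<Sum>k\<in>{1..N}. \<integral>\<^sup>+ y. ennreal (\<bar>y - step_map y\<bar>\<^sup>2) * indicator (cell k) y \<partial>\<rho>)"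
    by (rule R.nn_integral_cells) measurable
  also have "\<dots> = (\<Sum>k\<in>{1..N}. \<integral>\<^sup>+ y. ennreal (\<bar>y - z k\<bar>\<^sup>2) * indicator (cell k) y \<partial>\<rho>)"
    using step_map_cell by (intro sum.cong refl nn_integral_cong) (auto split: split_indicator)
  finally show "(\<integral>\<^sup>+ y. ennreal (\<bar>y - step_map y\<bar>\<^sup>2) \<partial>\<rho>) =
      (\<Sum>k\<in>{1..N}. \<integral>\<^sup>+ y. ennreal (\<bar>y - z k\<bar>\<^sup>2) * indicator (cell k) y \<partial>\<rho>)" .
qed

text \<open>The monotone map is optimal among couplings, hence its cost is the squared distance, and every
  optimal map has the same cells up to null sets.\<close>

lemma step_map_optimal:
  assumes cells: "equal_cells \<sigma> N cell" and s: "sets \<sigma> = sets borel" and mass: "emeasure \<sigma> {a..b} = 1"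
  shows "W2_sq (empirical_measure N z) \<sigma> = (\<integral>\<^sup>+ y. ennreal (\<bar>y - step_map y\<bar>\<^sup>2) \<partial>\<sigma>)"
    and "\<And>T. is_optimal_transport_map \<sigma> (empirical_measure N z) T \<Longrightarrow>
      AE y in \<sigma>. \<forall>k\<in>{1..N}. T y = z k \<longleftrightarrow> y \<in> cell k"
proof -
  interpret R: equal_cells \<sigma> N cell by fact
  have contact: "AE y in \<sigma>. step_map y * y = source_potential y + target_potential (step_map y)"
    using R.AE_covered
  proof eventually_elim
    case (elim y)
    then obtain k where "k \<in> {1..N}" "y \<in> cell k" by auto
    then show ?case using step_map_cell contact_iff by simp
  qed
  have young: "AE x in empirical_measure N z. \<forall>y. x * y \<le> source_potential y + target_potential x"
    using AE_empirical_measure[OF N] by eventually_elim (use young_inequality in auto)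
  note int = integrable_empirical_measure[of "\<lambda>x. x\<^sup>2" N z]
    integrable_continuous_bounded_support[OF R.prob_space_axioms s mass]
    integrable_empirical_measure[OF target_potential_measurable, of N z]
  have iy: "integrable \<sigma> (\<lambda>y. y\<^sup>2)" by (intro int(2) continuous_intros)
  note opt = contact_map_optimal[OF s int(1) iy int(3) int(2)[OF continuous_source_potential]
    young step_map_transports(1)[OF cells s] contact]
  show "W2_sq (empirical_measure N z) \<sigma> = (\<integral>\<^sup>+ y. ennreal (\<bar>y - step_map y\<bar>\<^sup>2) \<partial>\<sigma>)"
    by (rule opt(1)) measurable
  fix T assume T: "is_optimal_transport_map \<sigma> (empirical_measure N z) T"
  then have T': "T \<in> borel_measurable borel" "distr \<sigma> borel T = empirical_measure N z"
    by (auto simp: is_optimal_transport_map_def is_arg_min_def transport_maps_def)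
  have "T \<in> measurable \<sigma> borel" using T'(1) by (simp only: measurable_cong_sets[OF s refl])
  moreover have "AE t in distr \<sigma> borel T. t \<in> z ` {1..N}"
    unfolding T'(2) by (rule AE_empirical_measure[OF N])
  ultimately have "AE y in \<sigma>. T y \<in> z ` {1..N}" by (rule AE_distrD)
  moreover have "AE y in \<sigma>. T y * y = source_potential y + target_potential (T y)"
    by (rule opt(2)[OF _ T]) measurable
  ultimately show "AE y in \<sigma>. \<forall>k\<in>{1..N}. T y = z k \<longleftrightarrow> y \<in> cell k"
    using R.AE_covered
  proof eventually_elim
    case (elim y)
    then obtain j i where j: "j \<in> {1..N}" "y \<in> cell j" and i: "i \<in> {1..N}" "T y = z i" by auto
    then have "i = j" using contact_iff[of i j y] elim(2) by simp
    with j i show ?case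
      by (metis z_le_iff order_antisym order_refl step_map_cell)
  qed
qed

section \<open>The projection is uniform on an interval in each cell\<close>

text \<open>The competitor \<open>\<rho>\<close> keeps the mass \<open>1 / N\<close> in each cell but concentrates it, with density one, on
  the interval closest to the target of that cell. The same monotone map still transports \<open>\<rho>\<close> to the
  empirical measure, so minimality of \<open>\<sigma>\<close> bounds the sum of the cell costs \<open>B k\<close> of \<open>\<sigma>\<close> by the sum of
  the cell costs \<open>A k\<close> of \<open>\<rho>\<close>. As \<open>A k \<le> B k\<close> cell by cell, all of them are equal, and the case of
  equality in \<open>bathtub\<close> identifies \<open>\<sigma>\<close>. Intervals are open so that each lies inside its open
  cell and they are disjoint.\<close>

lemma projection_uniform_on_intervals:
  assumes cells: "equal_cells \<sigma> N cell"
    and proj: "is_W2_projection {a..b} (empirical_measure N z) \<sigma>"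
    and q_range: "\<And>k. k \<le> N \<Longrightarrow> q k \<in> {a..b}"
    and k: "k \<in> {1..N}"
  shows "\<exists>c. density \<sigma> (indicator (cell k)) = density lborel (indicator {c<..<c + 1 / real N})"
proof -
  let ?\<mu> = "empirical_measure N z"
  interpret R: equal_cells \<sigma> N cell by fact
  have s: "sets \<sigma> = sets borel" and mass: "emeasure \<sigma> {a..b} = 1" and dens: "density_le_one \<sigma>"
    and best: "\<And>\<rho>. \<rho> \<in> prob_measures_on {a..b} \<Longrightarrow> density_le_one \<rho> \<Longrightarrow> W2_sq ?\<mu> \<sigma> \<le> W2_sq ?\<mu> \<rho>"
    using proj unfolding is_W2_projection_def is_arg_min_def prob_measures_on_def
    by (auto simp: not_less[symmetric])
  obtain f where [measurable]: "f \<in> borel_measurable borel" and f: "\<And>y. 0 \<le> f y" "\<And>y. f y \<le> 1"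
    and \<sigma>: "\<sigma> = density lborel (\<lambda>y. ennreal (f y))"
    using density_le_one_real[OF dens] by blast
  have Npos: "0 < 1 / real N" using N by simp
  have on_cell: "(\<integral>\<^sup>+ y. h y * indicator (cell k) y \<partial>\<sigma>) =
      (\<integral>\<^sup>+ y. h y * (ennreal (f y) * indicator (cell k) y) \<partial>lborel)"
    if [measurable]: "h \<in> borel_measurable borel" for h k
    unfolding \<sigma> by (subst nn_integral_density) (auto simp: ac_simps)
  \<comment> \<open>the conclusion of \<open>bathtub\<close> in cell \<open>k\<close>, with costs \<open>A\<close> of the interval and \<open>B\<close> of \<open>\<sigma>\<close>\<close>
  define good where "good k c A B \<longleftrightarrow> {c<..<c + 1 / real N} \<subseteq> cell k \<and>
      (\<integral>\<^sup>+ y. ennreal (\<bar>y - z k\<bar>\<^sup>2) * indicator {c<..<c + 1 / real N} y \<partial>lborel) = ennreal A \<and> 0 \<le> A \<and>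
      (\<integral>\<^sup>+ y. ennreal (\<bar>y - z k\<bar>\<^sup>2) * indicator (cell k) y \<partial>\<sigma>) = ennreal B \<and> A \<le> B \<and>
      (B = A \<longrightarrow> (AE y in lborel. f y * indicator (cell k) y = indicator {c<..<c + 1 / real N} y))"
    for k c A B
  have "\<forall>k\<in>{1..N}. \<exists>c A B. good k c A B"
  proof
    fix k assume k: "k \<in> {1..N}"
    have "(\<integral>\<^sup>+ y. ennreal (f y) * indicator {q (k - 1)<..<q k} y \<partial>lborel) = ennreal (1 / real N)"
      using R.mass_C[OF k] on_cell[of "\<lambda>_. 1" k] s by (simp add: cell_def)
    then show "\<exists>c A B. good k c A B"
    proof (rule bathtub[OF \<open>f \<in> borel_measurable borel\<close> f Npos, where t = "z k"])
      fix c A B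
      assume *: "{c<..<c + 1 / real N} \<subseteq> {q (k - 1)<..<q k}"
        "(\<integral>\<^sup>+ y. ennreal (\<bar>y - z k\<bar>\<^sup>2) * indicator {c<..<c + 1 / real N} y \<partial>lborel) = ennreal A" "0 \<le> A"
        "(\<integral>\<^sup>+ y. ennreal (\<bar>y - z k\<bar>\<^sup>2) * (ennreal (f y) * indicator {q (k - 1)<..<q k} y) \<partial>lborel) = ennreal B"
        "A \<le> B"
        "B = A \<Longrightarrow> AE y in lborel. f y * indicator {q (k - 1)<..<q k} y = indicator {c<..<c + 1 / real N} y"
      have "(\<integral>\<^sup>+ y. ennreal (\<bar>y - z k\<bar>\<^sup>2) * indicator (cell k) y \<partial>\<sigma>) = ennreal B"
        unfolding *(4)[symmetric] cell_def[symmetric] by (rule on_cell) measurable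
      then have "good k c A B"
        unfolding good_def using *(1,2,3,5,6) by (simp add: cell_def)
      then show "\<exists>c A B. good k c A B" by blast
    qed
  qed
  then obtain c A B where good: "\<forall>k\<in>{1..N}. good k (c k) (A k) (B k)"
    unfolding bchoice_iff by blast
  have c: "{c k<..<c k + 1 / real N} \<subseteq> cell k"
    and A: "(\<integral>\<^sup>+ y. ennreal (\<bar>y - z k\<bar>\<^sup>2) * indicator {c k<..<c k + 1 / real N} y \<partial>lborel) = ennreal (A k)"
      "0 \<le> A k"
    and B: "(\<integral>\<^sup>+ y. ennreal (\<bar>y - z k\<bar>\<^sup>2) * indicator (cell k) y \<partial>\<sigma>) = ennreal (B k)"
    and AB: "A k \<le> B k"
    and eq: "B k = A k \<Longrightarrow> AE y in lborel. f y * indicator (cell k) y = indicator {c k<..<c k + 1 / real N} y"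
    if "k \<in> {1..N}" for k
    using bspec[OF good that] unfolding good_def by blast+
  define J where "J k = {c k<..<c k + 1 / real N}" for k
  define U where "U = (\<Union>k\<in>{1..N}. J k)"
  define \<rho> where "\<rho> = density lborel (indicator U)"
  have [measurable]: "J k \<in> sets borel" "U \<in> sets borel" for k by (auto simp: J_def U_def)
  have s\<rho>: "sets \<rho> = sets borel" by (simp add: \<rho>_def)
  have J_mass: "emeasure lborel (J k) = ennreal (1 / real N)" for k using Npos by (simp add: J_def)
  have J_cell: "J k \<subseteq> cell k" if "k \<in> {1..N}" for k using c that by (simp add: J_def)
  have J_disj: "disjoint_family_on J {1..N}"
    using disjoint_cells J_cell unfolding disjoint_family_on_def by fast
  have U_cell: "U \<inter> cell k = J k" if k: "k \<in> {1..N}" for k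
  proof
    show "U \<inter> cell k \<subseteq> J k"
      using disjoint_cells J_cell k unfolding disjoint_family_on_def U_def by fast
  qed (use J_cell k in \<open>auto simp: U_def\<close>)
  have em\<rho>: "emeasure \<rho> X = emeasure lborel (U \<inter> X)" if "X \<in> sets borel" for X
    using that unfolding \<rho>_def by (subst emeasure_density) (auto simp: indicator_inter_arith[symmetric])
  have U_mass: "emeasure lborel U = 1"
  proof -
    have "emeasure lborel U = (\<Sum>k\<in>{1..N}. emeasure lborel (J k))"
      unfolding U_def using J_disj by (intro sum_emeasure[symmetric]) auto
    also have "\<dots> = of_nat N * ennreal (1 / real N)" by (simp add: J_mass)
    also have "\<dots> = 1"
      using N by (subst ennreal_of_nat_eq_real_of_nat) (simp add: ennreal_mult[symmetric])
    finally show ?thesis .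
  qed
  have prob\<rho>: "prob_space \<rho>"
    using em\<rho>[of UNIV] U_mass by (intro prob_spaceI) (simp add: \<rho>_def)
  have "U \<subseteq> {a..b}"
  proof -
    have "cell k \<subseteq> {a..b}" if "k \<in> {1..N}" for k
    proof -
      have "q (k - 1) \<in> {a..b}" "q k \<in> {a..b}"
        using that q_range[of k] q_range[of "k - 1"] by (simp_all add: le_diff_conv)
      then show ?thesis by (auto simp: cell_def)
    qed
    then show ?thesis using J_cell unfolding U_def by blast
  qed
  then have "U \<inter> {a..b} = U" by auto
  then have "\<rho> \<in> prob_measures_on {a..b}"
    using prob\<rho> em\<rho>[of "{a..b}"] U_mass s\<rho> by (simp add: prob_measures_on_def)
  moreover have "density_le_one \<rho>"
    unfolding density_le_one_def \<rho>_def
    by (intro bexI[of _ "indicator U"]) (auto split: split_indicator)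
  moreover have cells\<rho>: "equal_cells \<rho> N cell"
    by (rule equal_cells.intro[OF prob\<rho>], unfold_locales)
       (use N disjoint_cells s\<rho> in \<open>simp_all add: em\<rho> U_cell J_mass\<close>)
  ultimately have "W2_sq ?\<mu> \<sigma> \<le> (\<integral>\<^sup>+ y. ennreal (\<bar>y - step_map y\<bar>\<^sup>2) \<partial>\<rho>)"
    using best W2_sq_le_transport_cost[OF step_map_transports(1)[OF cells\<rho> s\<rho>] s\<rho>] by (meson order_trans)
  also have "\<dots> = (\<Sum>k\<in>{1..N}. ennreal (A k))"
    unfolding step_map_transports(2)[OF cells\<rho> s\<rho>]
  proof (intro sum.cong refl)
    fix k assume k: "k \<in> {1..N}"
    have "indicator U y * (indicator (cell k) y :: ennreal) = indicator (J k) y" for y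
      using U_cell[OF k] by (metis indicator_inter_arith)
    then have "indicator U y * (h * (indicator (cell k) y :: ennreal)) = h * indicator (J k) y" for y h
      by (metis mult.left_commute)
    then show "(\<integral>\<^sup>+ y. ennreal (\<bar>y - z k\<bar>\<^sup>2) * indicator (cell k) y \<partial>\<rho>) = ennreal (A k)"
      unfolding \<rho>_def A(1)[OF k, symmetric] J_def[symmetric]
      by (subst nn_integral_density) auto
  qed
  finally have "(\<Sum>k\<in>{1..N}. ennreal (B k)) \<le> (\<Sum>k\<in>{1..N}. ennreal (A k))"
    unfolding step_map_optimal(1)[OF cells s mass] step_map_transports(2)[OF cells s] by (simp only: B cong: sum.cong)
  moreover have "0 \<le> B k" if "k \<in> {1..N}" for k using A(2)[OF that] AB[OF that] by simp
  ultimately have "ennreal (\<Sum>k\<in>{1..N}. B k) \<le> ennreal (\<Sum>k\<in>{1..N}. A k)"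
    using A(2) by (simp only: sum_ennreal)
  then have "(\<Sum>k\<in>{1..N}. B k) \<le> (\<Sum>k\<in>{1..N}. A k)"
    by (subst (asm) ennreal_le_iff) (auto intro!: sum_nonneg A(2))
  moreover have "(\<Sum>k\<in>{1..N}. A k) \<le> (\<Sum>k\<in>{1..N}. B k)" by (intro sum_mono AB)
  ultimately have "A k = B k"
    using AB k by (intro sum_mono_inv[of A "{1..N}" B]) auto
  then have ae: "AE y in lborel. f y * indicator (cell k) y = indicator (J k) y"
    using eq[OF k] by (simp add: J_def)
  have "density \<sigma> (indicator (cell k)) = density lborel (\<lambda>y. ennreal (f y) * indicator (cell k) y)"
    unfolding \<sigma> by (rule density_density_eq) auto
  also have "\<dots> = density lborel (indicator (J k))"
  proof (rule density_cong)
    show "AE y in lborel. ennreal (f y) * indicator (cell k) y = indicator (J k) y"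
      using ae by eventually_elim (metis ennreal_indicator ennreal_mult f(1) indicator_pos_le)
  qed auto
  finally show ?thesis unfolding J_def by blast
qed

end

text \<open>Without atoms the distribution function is continuous and takes every level \<open>k / N\<close>. The
  levels \<open>0\<close> and \<open>1\<close> are attained inside \<open>[a, b]\<close> too, so the outer cells stay in the interval.\<close>

lemma quantiles:
  assumes "prob_space \<sigma>" and s: "sets \<sigma> = sets borel" and mass: "emeasure \<sigma> {a..b::real} = 1"
    and atomless: "\<And>y. emeasure \<sigma> {y} = 0" and N: "N \<ge> 1"
  obtains q where "strict_mono_on {..N} q" "\<And>k. k \<le> N \<Longrightarrow> q k \<in> {a..b}"
    "\<And>k. k \<in> {1..N} \<Longrightarrow> emeasure \<sigma> {q (k - 1)<..<q k} = ennreal (1 / real N)"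
proof -
  interpret prob_space \<sigma> by fact
  interpret real_distribution \<sigma>
    using s sets_eq_imp_space_eq[OF s] by unfold_locales auto
  have atom: "measure \<sigma> {y} = 0" for y using atomless by (simp add: measure_def)
  have m1: "measure \<sigma> {a..b} = 1" using mass by (simp add: measure_def)
  have ab: "a \<le> b" using mass by (cases "a \<le> b") auto
  have cont: "isCont (cdf \<sigma>) y" for y using atom by (simp add: isCont_cdf)
  have "cdf \<sigma> a = 0"
  proof -
    have "measure \<sigma> ({..<a} \<union> {a..b}) = measure \<sigma> {..<a} + measure \<sigma> {a..b}"
      by (intro finite_measure_Union) auto
    moreover have "measure \<sigma> ({..<a} \<union> {a..b}) \<le> 1" by simp
    ultimately have "measure \<sigma> {..<a} \<le> 0" using m1 by simp
    moreover have "measure \<sigma> ({..<a} \<union> {a}) = measure \<sigma> {..<a} + measure \<sigma> {a}"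
      by (intro finite_measure_Union) auto
    moreover have "{..<a} \<union> {a} = {..a}" by auto
    ultimately show ?thesis using atom[of a] by (simp add: cdf_def measure_le_0_iff)
  qed
  moreover have "cdf \<sigma> b = 1"
  proof -
    have "measure \<sigma> {a..b} \<le> measure \<sigma> {..b}" by (intro finite_measure_mono) auto
    then show ?thesis using m1 cdf_bounded_prob[of b] unfolding cdf_def by linarith
  qed
  ultimately have "\<exists>y. a \<le> y \<and> y \<le> b \<and> cdf \<sigma> y = real k / real N" if "k \<le> N" for k
    using that N ab cont by (intro IVT) auto
  then obtain q where q: "\<And>k. k \<le> N \<Longrightarrow> a \<le> q k \<and> q k \<le> b \<and> cdf \<sigma> (q k) = real k / real N"
    by metis
  have mono: "q i < q j" if "i < j" "j \<le> N" for i j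
  proof (rule ccontr)
    assume "\<not> q i < q j"
    then have "cdf \<sigma> (q j) \<le> cdf \<sigma> (q i)" by (intro cdf_nondecreasing) simp
    then show False using q[of i] q[of j] that N by (simp add: divide_le_cancel)
  qed
  show ?thesis
  proof (rule that)
    show "strict_mono_on {..N} q" using mono by (auto simp: strict_mono_on_def)
    show "q k \<in> {a..b}" if "k \<le> N" for k using q that by auto
    show "emeasure \<sigma> {q (k - 1)<..<q k} = ennreal (1 / real N)" if k: "k \<in> {1..N}" for k
    proof -
      have lt: "q (k - 1) < q k" using k by (intro mono) auto
      have "measure \<sigma> {q (k - 1)<..q k} = real k / real N - real (k - 1) / real N"
      proof -
        have "k \<le> N" "k - 1 \<le> N" using k by auto
        then show ?thesis using cdf_diff_eq[OF lt] q[of k] q[of "k - 1"] by simp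
      qed
      also have "\<dots> = 1 / real N" using k by (simp add: of_nat_diff diff_divide_distrib[symmetric])
      finally have "measure \<sigma> {q (k - 1)<..q k} = 1 / real N" .
      moreover have "measure \<sigma> ({q (k - 1)<..<q k} \<union> {q k}) = measure \<sigma> {q (k - 1)<..<q k} + measure \<sigma> {q k}"
        by (intro finite_measure_Union) auto
      moreover have "{q (k - 1)<..<q k} \<union> {q k} = {q (k - 1)<..q k}" using lt by auto
      ultimately show ?thesis using atom[of "q k"] by (simp add: emeasure_eq_measure)
    qed
  qed
qed

text \<open>The cells of the monotone map and of \<open>T\<close> agree up to \<open>\<sigma>\<close>-null sets, so the description of \<open>\<sigma>\<close> on
  quantile cells carries over to the Laguerre cells.\<close>

lemma laguerre_cells_uniform:
  assumes N: "N \<ge> 1" and z: "strict_mono_on {1..N} z"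
    and proj: "is_W2_projection {a..b} (empirical_measure N z) \<sigma>"
    and T: "is_optimal_transport_map \<sigma> (empirical_measure N z) T"
    and k: "k \<in> {1..N}"
  shows "\<exists>c. density \<sigma> (indicator (T -` {z k})) = density lborel (indicator {c<..<c + 1 / real N})"
proof -
  have prob: "prob_space \<sigma>" and s: "sets \<sigma> = sets borel" and mass: "emeasure \<sigma> {a..b} = 1"
    and dens: "density_le_one \<sigma>"
    using proj unfolding is_W2_projection_def is_arg_min_def prob_measures_on_def by auto
  note [measurable_cong] = s
  obtain f where f[measurable]: "f \<in> borel_measurable lborel" and \<sigma>: "\<sigma> = density lborel f"
    using dens by (auto simp: density_le_one_def)
  have "emeasure \<sigma> {y} = 0" for y
    unfolding \<sigma> using AE_lborel_singleton[of y]
    by (subst emeasure_density) (auto simp: nn_integral_0_iff_AE split: split_indicator elim!: eventually_mono)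
  from quantiles[OF prob s mass this N] obtain q where quant: "strict_mono_on {..N} q"
    "\<And>k. k \<le> N \<Longrightarrow> q k \<in> {a..b}"
    "\<And>k. k \<in> {1..N} \<Longrightarrow> emeasure \<sigma> {q (k - 1)<..<q k} = ennreal (1 / real N)" by blast
  interpret monotone_steps N z q by (rule monotone_steps.intro[OF N z quant(1)])
  have cells: "equal_cells \<sigma> N cell"
    by (rule equal_cells.intro[OF prob], unfold_locales)
       (use N disjoint_cells s quant(3) in \<open>simp_all add: cell_def\<close>)
  have [measurable]: "T \<in> borel_measurable borel"
    using T by (auto simp: is_optimal_transport_map_def is_arg_min_def transport_maps_def)
  have restrict: "density \<sigma> (indicator (T -` {z k})) = density \<sigma> (indicator (cell k))"
  proof (rule density_cong)
    show "AE y in \<sigma>. indicator (T -` {z k}) y = (indicator (cell k) y :: ennreal)"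
      using step_map_optimal(2)[OF cells s mass T]
      by eventually_elim (use k in \<open>auto split: split_indicator\<close>)
    have "T -` {z k} \<in> sets borel" using measurable_sets_borel[of T borel "{z k}"] by simp
    then show "indicator (T -` {z k}) \<in> borel_measurable \<sigma>" by simp
  qed measurable
  show ?thesis
    unfolding restrict by (rule projection_uniform_on_intervals[OF cells proj quant(2) k])
qed

section \<open>Quantization error at the barycenters\<close>

lemma mean_of_interval:
  fixes c m :: real
  assumes "0 < m"
  shows "(\<integral>y. indicator {c..c + m} y *\<^sub>R y \<partial>lborel) = m * (c + m / 2)"
proof -
  have "(\<integral>y. y * indicator {c..c + m} y \<partial>lborel) = (c + m)\<^sup>2 / 2 - c\<^sup>2 / 2"
    using assms by (intro integral_FTC_Icc_real) (auto intro!: derivative_eq_intros)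
  also have "\<dots> = m * (c + m / 2)" by (simp add: power2_eq_square field_simps)
  finally show ?thesis by (simp add: mult.commute)
qed

lemma variance_of_interval:
  fixes c m :: real
  assumes "0 < m"
  shows "(\<integral>\<^sup>+ y. ennreal (\<bar>y - (c + m / 2)\<bar>\<^sup>2) * indicator {c..c + m} y \<partial>lborel) = ennreal (m ^ 3 / 12)"
proof -
  have "(\<integral>\<^sup>+ y. ennreal ((y - (c + m / 2))\<^sup>2) * indicator {c..c + m} y \<partial>lborel) =
      ennreal (((c + m) - (c + m / 2)) ^ 3 / 3 - (c - (c + m / 2)) ^ 3 / 3)"
    using assms by (intro nn_integral_FTC_Icc) (auto intro!: derivative_eq_intros)
  also have "((c + m) - (c + m / 2)) ^ 3 / 3 - (c - (c + m / 2)) ^ 3 / 3 = m ^ 3 / 12"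
    by (simp add: power3_eq_cube field_simps)
  finally show ?thesis by simp
qed

lemma sorted_enumeration:
  assumes "finite A" "card A = N"
  obtains z :: "nat \<Rightarrow> real" where "strict_mono_on {1..N} z" "z ` {1..N} = A"
proof -
  define xs where "xs = sorted_list_of_set A"
  have len: "length xs = N" and set: "set xs = A" and srt: "sorted_wrt (<) xs"
    using assms by (auto simp: xs_def)
  show ?thesis
  proof (rule that[of "\<lambda>k. xs ! (k - 1)"])
    show "strict_mono_on {1..N} (\<lambda>k. xs ! (k - 1))"
      using len by (auto simp: strict_mono_on_def intro!: sorted_wrt_nth_less[OF srt])
    have "(\<lambda>k. xs ! (k - 1)) ` {1..N} = (!) xs ` {..<N}"
      unfolding image_Suc_lessThan[symmetric] image_image by simp
    then show "(\<lambda>k. xs ! (k - 1)) ` {1..N} = A"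
      using nth_image[of N xs] len set by (simp add: lessThan_atLeast0)
  qed
qed

theorem proposition4p1:
  fixes a b \<epsilon> :: real and \<Omega> :: "real set" and N :: nat
    and x \<beta> :: "nat \<Rightarrow> real" and \<mu> \<sigma> :: "real measure"
    and T :: "real \<Rightarrow> real" and L :: "nat \<Rightarrow> real set"
  assumes "\<Omega> = {a..b}" and "b - a \<ge> 1"
    and "N \<ge> 1" and "inj_on x {1..N}"
    and "\<mu> = empirical_measure N x"
    and "is_W2_projection \<Omega> \<mu> \<sigma>"
    and "is_optimal_transport_map \<sigma> \<mu> T"
    and "\<And>i. i \<in> {1..N} \<Longrightarrow> L i = T -` {x i}"
    and "\<And>i. i \<in> {1..N} \<Longrightarrow> \<beta> i = real N * (LINT y:L i|\<sigma>. y)"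
    and "\<epsilon> = 1 / real N"
  shows "ennreal (1 / \<epsilon>\<^sup>2) * W2_sq \<sigma> (empirical_measure N \<beta>) \<le> ennreal (1 / 12)"
proof -
  note N = \<open>N \<ge> 1\<close> and inj = \<open>inj_on x {1..N}\<close>
  have prob: "prob_space \<sigma>" and s: "sets \<sigma> = sets borel"
    using assms(6) unfolding is_W2_projection_def is_arg_min_def prob_measures_on_def by auto
  note [measurable_cong] = s
  have T[measurable]: "T \<in> borel_measurable borel"
    using assms(7) by (auto simp: is_optimal_transport_map_def is_arg_min_def transport_maps_def)
  have L_sets[measurable]: "L i \<in> sets borel" if "i \<in> {1..N}" for i
    using measurable_sets_borel[OF T, of "{x i}"] assms(8)[OF that] by simp
  define m where "m = 1 / real N"
  have m: "0 < m" using N by (simp add: m_def)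
  obtain z where z: "strict_mono_on {1..N} z" "z ` {1..N} = x ` {1..N}"
    using sorted_enumeration[of "x ` {1..N}" N] inj by (auto simp: card_image)
  have \<mu>: "\<mu> = empirical_measure N z"
    unfolding assms(5)
    by (rule empirical_measure_cong_image[OF N inj strict_mono_on_imp_inj_on[OF z(1)] z(2)[symmetric]])
  have "\<forall>i\<in>{1..N}. \<exists>c. density \<sigma> (indicator (L i)) = density lborel (indicator {c..c + m})"
  proof
    fix i assume i: "i \<in> {1..N}"
    then have "x i \<in> z ` {1..N}" unfolding z(2) by (rule imageI)
    then obtain k where k: "k \<in> {1..N}" "x i = z k" by blast
    then obtain c where "density \<sigma> (indicator (L i)) = density lborel (indicator {c<..<c + m})"
      using laguerre_cells_uniform[OF N z(1) assms(6)[unfolded assms(1) \<mu>] assms(7)[unfolded \<mu>] k(1)]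
      unfolding assms(8)[OF i] k(2) m_def by blast
    also have "\<dots> = density lborel (indicator {c..c + m})"
    proof (rule density_cong)
      show "AE y in lborel. indicator {c<..<c + m} y = (indicator {c..c + m} y :: ennreal)"
        using AE_lborel_singleton[of c] AE_lborel_singleton[of "c + m"]
        by eventually_elim (auto split: split_indicator)
    qed auto
    finally show "\<exists>c. density \<sigma> (indicator (L i)) = density lborel (indicator {c..c + m})" by blast
  qed
  then obtain c where c: "\<And>i. i \<in> {1..N} \<Longrightarrow>
      density \<sigma> (indicator (L i)) = density lborel (indicator {c i..c i + m})"
    unfolding bchoice_iff by blast
  have on_L: "(\<integral>\<^sup>+ y. h y * indicator (L i) y \<partial>\<sigma>) = (\<integral>\<^sup>+ y. h y * indicator {c i..c i + m} y \<partial>lborel)"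
    if i: "i \<in> {1..N}" and [measurable]: "h \<in> borel_measurable borel" for i h
  proof -
    have "(\<integral>\<^sup>+ y. h y * indicator (L i) y \<partial>\<sigma>) = (\<integral>\<^sup>+ y. h y \<partial>density \<sigma> (indicator (L i)))"
      using L_sets[OF i] by (subst nn_integral_density) (auto simp: mult.commute)
    then show ?thesis
      unfolding c[OF i] by (subst (asm) nn_integral_density) (auto simp: mult.commute)
  qed
  have \<beta>: "\<beta> i = c i + m / 2" if i: "i \<in> {1..N}" for i
  proof -
    have "(LINT y:L i|\<sigma>. y) = (\<integral>y. y \<partial>density \<sigma> (\<lambda>y. ennreal (indicator (L i) y)))"
      unfolding set_lebesgue_integral_def using L_sets[OF i] by (subst integral_density) auto
    also have "\<dots> = (\<integral>y. y \<partial>density lborel (\<lambda>y. ennreal (indicator {c i..c i + m} y)))"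
      using c[OF i] by (simp add: ennreal_indicator)
    also have "\<dots> = m * (c i + m / 2)"
      using mean_of_interval[OF m, of "c i"] by (subst integral_density) auto
    finally show ?thesis unfolding assms(9)[OF i] using N by (simp add: m_def)
  qed
  interpret L: equal_cells \<sigma> N L
  proof (rule equal_cells.intro[OF prob], unfold_locales)
    show "disjoint_family_on L {1..N}"
      unfolding disjoint_family_on_def
    proof (intro ballI impI)
      fix i j assume ij: "i \<in> {1..N}" "j \<in> {1..N}" "i \<noteq> j"
      then have "x i \<noteq> x j" using inj by (simp add: inj_on_eq_iff)
      then show "L i \<inter> L j = {}" unfolding assms(8)[OF ij(1)] assms(8)[OF ij(2)] by auto
    qed
    fix i assume i: "i \<in> {1..N}"
    show "L i \<in> sets \<sigma>" using L_sets[OF i] s by simp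
    then have "emeasure \<sigma> (L i) = (\<integral>\<^sup>+ y. 1 * indicator (L i) y \<partial>\<sigma>)" by simp
    also have "\<dots> = emeasure lborel {c i..c i + m}" by (subst on_L[OF i]) simp_all
    also have "\<dots> = ennreal (1 / real N)" using m by (simp add: m_def)
    finally show "emeasure \<sigma> (L i) = ennreal (1 / real N)" .
  qed fact
  \<comment> \<open>sending each cell to its barycenter is one admissible transport; its cost bounds the distance\<close>
  define R where "R y = (\<Sum>i\<in>{1..N}. \<beta> i * indicator (L i) y)" for y
  have R_cell: "R y = \<beta> i" if "i \<in> {1..N}" "y \<in> L i" for i y
  proof -
    have "R y = (\<Sum>j\<in>{1..N}. if j = i then \<beta> j else 0)"
      unfolding R_def
    proof (intro sum.cong refl)
      fix j assume j: "j \<in> {1..N}"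
      have "y \<in> L j \<longleftrightarrow> j = i"
        using that inj unfolding assms(8)[OF j] assms(8)[OF that(1)] by (auto simp: inj_on_eq_iff[OF inj that(1) j])
      then show "\<beta> j * indicator (L j) y = (if j = i then \<beta> j else 0)" using that(2) by auto
    qed
    then show ?thesis using that by simp
  qed
  have R[measurable]: "R \<in> borel_measurable borel"
    unfolding R_def[abs_def] using L_sets by (intro borel_measurable_sum borel_measurable_times) auto
  have "distr \<sigma> borel R = empirical_measure N \<beta>"
    using R_cell by (intro L.distr_eq_empirical_measure) auto
  then have "W2_sq \<sigma> (empirical_measure N \<beta>) \<le> (\<integral>\<^sup>+ y. ennreal (\<bar>y - R y\<bar>\<^sup>2) \<partial>\<sigma>)"
    unfolding W2_sq_commute[of \<sigma>] using s by (intro W2_sq_le_transport_cost) (auto simp: transport_maps_def)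
  also have "\<dots> = (\<Sum>i\<in>{1..N}. \<integral>\<^sup>+ y. ennreal (\<bar>y - R y\<bar>\<^sup>2) * indicator (L i) y \<partial>\<sigma>)"
    by (rule L.nn_integral_cells) measurable
  also have "\<dots> = (\<Sum>i\<in>{1..N}. ennreal (m ^ 3 / 12))"
  proof (intro sum.cong refl)
    fix i assume i: "i \<in> {1..N}"
    have "(\<integral>\<^sup>+ y. ennreal (\<bar>y - R y\<bar>\<^sup>2) * indicator (L i) y \<partial>\<sigma>) =
        (\<integral>\<^sup>+ y. ennreal (\<bar>y - \<beta> i\<bar>\<^sup>2) * indicator (L i) y \<partial>\<sigma>)"
      using R_cell[OF i] by (intro nn_integral_cong) (auto split: split_indicator)
    also have "\<dots> = ennreal (m ^ 3 / 12)"
      using variance_of_interval[OF m, of "c i"] by (subst on_L[OF i]) (simp_all add: \<beta>[OF i])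
    finally show "(\<integral>\<^sup>+ y. ennreal (\<bar>y - R y\<bar>\<^sup>2) * indicator (L i) y \<partial>\<sigma>) = ennreal (m ^ 3 / 12)" .
  qed
  also have "\<dots> = ennreal (real N * (m ^ 3 / 12))"
    using m by (subst ennreal_mult) (simp_all add: ennreal_of_nat_eq_real_of_nat)
  finally have "ennreal (1 / \<epsilon>\<^sup>2) * W2_sq \<sigma> (empirical_measure N \<beta>) \<le>
      ennreal (1 / \<epsilon>\<^sup>2) * ennreal (real N * (m ^ 3 / 12))" by (rule mult_left_mono) simp
  also have "\<dots> = ennreal (1 / \<epsilon>\<^sup>2 * (real N * (m ^ 3 / 12)))"
    using m by (intro ennreal_mult[symmetric]) auto
  also have "1 / \<epsilon>\<^sup>2 * (real N * (m ^ 3 / 12)) = 1 / 12"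
    using N unfolding assms(10) m_def by (simp add: power2_eq_square power3_eq_cube)
  finally show ?thesis .
qed

end
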